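(* Let $k \geq 3$, $q \geq 1$, $t\geq 1$ and $v_1, v_2, \dots, v_{t-1}$ be integers such that there exist Steiner systems $H_i = S(2,k,v_i)$ for all $1 \leq i \leq t-1$. Denoting $n_i = \frac{v_i - 1}{k-1}$, assume that $n_1 = qk$ and $n_j = qk\prod_{i=1}^{j-1} v_i$ holds for all $2 \leq j \leq t-1$. Recursively define $$S_1(k) = qK_k, \qquad S_{i+1}(k) = \Gamma(S_i(k), H_i)$$ for $i = 1, \dots, t-1$. Then $S_t(k)$ is a graph of order $n_t = kq\prod_{i=1}^{t-1} v_i$ and constant link $tK_{k-1}$.
   Context: All graphs are finite and simple; order means number of vertices. A graph $G$ has constant link $L$ if for every vertex $v$ the subgraph induced by the open neighborhood $N(v)$ is isomorphic to $L$; $tL$ is the disjoint union of $t$ copies of $L$. A Steiner system $S(2,k,v)$ is a pair $(V,B)$ where $V$ is a set of $v$ points and $B$ is a family of $k$-element subsets of $V$ (blocks) such that each $2$-element subset of $V$ is contained in exactly one block. It is regarded as a $k$-uniform $\frac{v-1}{k-1}$-regular hypergraph with vertex set $V$ and edge set $B$. Construction of $\Gamma(G,H)$ (with the clique $K_k$): let $G$ be a graph of order $n$ and constant link $sK_{k-1}$ for some $s\ge1$, and $H$ an $n$-regular $k$-uniform hypergraph (every vertex in exactly $n$ edges, every edge of size $k$) with vertices $x_1,\dots,x_N$. (1) At each vertex $x$ of $H$ enumerate the hyperedges containing $x$ as $E_{x,1},\dots,E_{x,n}$. (2) Take $N$ disjoint copies of $G$ on vertex sets $V_1,\dots,V_N$,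 $V_i=\{v_{i,1},\dots,v_{i,n}\}$, and set $V(\Gamma)=V_1\cup\dots\cup V_N$. (3) With each edge $E$ of $H$ associate the $k$-element set $f(E)\subseteq V(\Gamma)$ defined by $v_{i,j}\in f(E)$ if and only if $E_{x_i,j}=E$. (4) For each hyperedge $E$ of $H$, place a copy of $K_k$ on the set $f(E)$. The resulting graph (for any choice of the enumerations) is $\Gamma(G,H)$. *)

theory Defs
  imports Complex_Main "Graph_Theory.Pair_Digraph" "Graph_Theory.Digraph_Isomorphism"
begin

text \<open>
  A finite simple graph is a \<^locale>\<open>pair_graph\<close>: a finite, loopless digraph without parallel arcs
  whose arc set is symmetric, so that an edge \<open>uv\<close> is the pair of arcs \<open>(u,v)\<close> and \<open>(v,u)\<close>.
\<close>

definition complete_graph :: "'a set \<Rightarrow> 'a pair_pre_digraph" where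
  "complete_graph A = \<lparr>pverts = A, parcs = {(u, v). u \<in> A \<and> v \<in> A \<and> u \<noteq> v}\<rparr>"

definition disjoint_copies :: "nat \<Rightarrow> 'a pair_pre_digraph \<Rightarrow> (nat \<times> 'a) pair_pre_digraph" where
  "disjoint_copies t L =
    \<lparr>pverts = {1..t} \<times> pverts L,
     parcs = {((c, a), (c, b)) | c a b. c \<in> {1..t} \<and> (a, b) \<in> parcs L}\<rparr>"

abbreviation copies_of_K :: "nat \<Rightarrow> nat \<Rightarrow> (nat \<times> nat) pair_pre_digraph" where
  "copies_of_K t m \<equiv> disjoint_copies t (complete_graph {1..m})"

definition open_nbhd :: "'a pair_pre_digraph \<Rightarrow> 'a \<Rightarrow> 'a set" where
  "open_nbhd G v = {u. (v, u) \<in> parcs G}"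

definition has_constant_link :: "'a pair_pre_digraph \<Rightarrow> 'b pair_pre_digraph \<Rightarrow> bool" where
  "has_constant_link G L \<longleftrightarrow>
    (\<forall>v \<in> pverts G. digraph_iso (with_proj G \<restriction> open_nbhd G v) (with_proj L))"

text \<open>A hypergraph is the pair of its vertex set and its set of hyperedges.\<close>

type_synonym 'a hypergraph = "'a set \<times> 'a set set"

definition hyperedges_at :: "'a hypergraph \<Rightarrow> 'a \<Rightarrow> 'a set set" where
  "hyperedges_at H x = {E \<in> snd H. x \<in> E}"

definition regular_uniform_hypergraph :: "nat \<Rightarrow> nat \<Rightarrow> 'a hypergraph \<Rightarrow> bool" where
  "regular_uniform_hypergraph n k H \<longleftrightarrow>
    finite (fst H) \<and>
    (\<forall>E \<in> snd H. E \<subseteq> fst H \<and> card E = k) \<and>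
    (\<forall>x \<in> fst H. card (hyperedges_at H x) = n)"

definition steiner_system_2 :: "nat \<Rightarrow> nat \<Rightarrow> 'a hypergraph \<Rightarrow> bool" where
  "steiner_system_2 k v H \<longleftrightarrow>
    finite (fst H) \<and> card (fst H) = v \<and>
    (\<forall>B \<in> snd H. B \<subseteq> fst H \<and> card B = k) \<and>
    (\<forall>P. P \<subseteq> fst H \<and> card P = 2 \<longrightarrow> (\<exists>!B. B \<in> snd H \<and> P \<subseteq> B))"

text \<open>
  The pair \<open>(x, j)\<close> is the vertex \<open>v\<^sub>x\<^sub>,\<^sub>j\<close>, that is, the \<open>j\<close>-th vertex of the copy of \<open>G\<close> at the
  vertex \<open>x\<close> of \<open>H\<close>. The argument \<open>g x\<close> enumerates the vertices of that copy by \<open>1, \<dots>, n\<close>, and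
  \<open>e x\<close> enumerates the hyperedges containing \<open>x\<close>.
\<close>

definition Gamma_clique_set ::
    "'a pair_pre_digraph \<Rightarrow> 'b hypergraph \<Rightarrow> ('b \<Rightarrow> nat \<Rightarrow> 'b set) \<Rightarrow> 'b set \<Rightarrow> ('b \<times> nat) set" where
  "Gamma_clique_set G H e E = {(x, j). x \<in> fst H \<and> j \<in> {1..card (pverts G)} \<and> e x j = E}"

definition Gamma_graph ::
    "'a pair_pre_digraph \<Rightarrow> 'b hypergraph \<Rightarrow> ('b \<Rightarrow> nat \<Rightarrow> 'a) \<Rightarrow> ('b \<Rightarrow> nat \<Rightarrow> 'b set)
      \<Rightarrow> ('b \<times> nat) pair_pre_digraph" where
  "Gamma_graph G H g e =
    \<lparr>pverts = fst H \<times> {1..card (pverts G)},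
     parcs =
       {((x, i), (x, j)) | x i j. x \<in> fst H \<and> i \<in> {1..card (pverts G)} \<and>
          j \<in> {1..card (pverts G)} \<and> (g x i, g x j) \<in> parcs G} \<union>
       (\<Union>E \<in> snd H. parcs (complete_graph (Gamma_clique_set G H e E)))\<rparr>"

text \<open>
  \<open>\<Gamma>(G,H)\<close> is defined when \<open>G\<close> has some order \<open>n\<close> and constant link \<open>sK\<^bsub>k-1\<^esub>\<close> with \<open>s \<ge> 1\<close>, and
  \<open>H\<close> is \<open>n\<close>-regular and \<open>k\<close>-uniform.
\<close>

definition Gamma_admissible :: "nat \<Rightarrow> 'a pair_pre_digraph \<Rightarrow> 'b hypergraph \<Rightarrow> bool" where
  "Gamma_admissible k G H \<longleftrightarrow>
    pair_graph G \<and> (\<exists>s \<ge> 1. has_constant_link G (copies_of_K s (k - 1))) \<and>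
    regular_uniform_hypergraph (card (pverts G)) k H"

text \<open>
  \<open>is_Gamma G H G'\<close> says that \<open>G'\<close> arises as \<open>\<Gamma>(G,H)\<close> for some choice of the enumerations. The
  admissibility conditions are deliberately not part of it, so that assuming \<open>is_Gamma\<close> does not
  assume anything about the order and links of \<open>G\<close>. For this reason the hyperedges at \<open>x\<close> are
  enumerated by \<open>1, \<dots>, deg x\<close>; in the admissible case \<open>deg x\<close> is the order of \<open>G\<close>.
\<close>

definition is_Gamma ::
    "'a pair_pre_digraph \<Rightarrow> 'b hypergraph \<Rightarrow> ('b \<times> nat) pair_pre_digraph \<Rightarrow> bool" where
  "is_Gamma G H G' \<longleftrightarrow>
    (\<exists>g e.
      (\<forall>x \<in> fst H. bij_betw (g x) {1..card (pverts G)} (pverts G)) \<and>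
      (\<forall>x \<in> fst H. bij_betw (e x) {1..card (hyperedges_at H x)} (hyperedges_at H x)) \<and>
      G' = Gamma_graph G H g e)"

text \<open>
  \<open>S 1, \<dots>, S t\<close> is a run of the recursion \<open>S\<^sub>1 = qK\<^sub>k\<close>, \<open>S\<^bsub>i+1\<^esub> = \<Gamma>(S\<^sub>i, H\<^sub>i)\<close>. The graph \<open>S 1\<close> is only
  required to be isomorphic to \<open>qK\<^sub>k\<close>, since all the graphs have to share one vertex type.
\<close>

definition S_sequence ::
    "nat \<Rightarrow> nat \<Rightarrow> nat \<Rightarrow> (nat \<Rightarrow> 'b hypergraph) \<Rightarrow> (nat \<Rightarrow> ('b \<times> nat) pair_pre_digraph) \<Rightarrow> bool" where
  "S_sequence k q t H S \<longleftrightarrow>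
    pair_graph (S 1) \<and> digraph_iso (with_proj (S 1)) (with_proj (copies_of_K q k)) \<and>
    (\<forall>i \<in> {1..<t}. is_Gamma (S i) (H i) (S (i + 1)))"

end

theory Submission
  imports Defs
begin

text \<open>
  Around the vertex \<open>v\<^sub>x\<^sub>,\<^sub>j\<close> of \<open>\<Gamma>(G,H)\<close> the neighbourhood consists of a copy of the neighbourhood in
  \<open>G\<close> and of the clique \<open>f(E)\<close> for \<open>E = E\<^sub>x\<^sub>,\<^sub>j\<close> minus the vertex itself. Since the hyperedges at a
  vertex are enumerated without repetition, \<open>f(E)\<close> meets each copy of \<open>G\<close> at most once, and two
  vertices in different copies are adjacent exactly when they carry the same hyperedge. Hence the
  two parts are not joined by edges and each \<open>\<Gamma>\<close>-step adds one clique \<open>K\<^bsub>k-1\<^esub>\<close> to the link.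
  A Steiner system is \<open>(v-1)/(k-1)\<close>-regular because the blocks through a point partition the
  remaining points.
\<close>

section \<open>Disjoint unions of cliques as relations on sets\<close>

text \<open>Encodes that \<open>R\<close> induces s disjoint copies of K_m on \<open>A\<close>:
  \<open>f\<close> labels each vertex by the index of its clique and a position inside it. With a
  relation and a set in place of graphs, links can be transported and glued without building
  isomorphisms.\<close>

definition cliques_on :: "'a rel \<Rightarrow> 'a set \<Rightarrow> nat \<Rightarrow> nat \<Rightarrow> bool" where
  "cliques_on R A s m \<longleftrightarrow>
    (\<exists>f. bij_betw f A ({1..s} \<times> {1..m}) \<and>
      (\<forall>u \<in> A. \<forall>w \<in> A. (u, w) \<in> R \<longleftrightarrow> u \<noteq> w \<and> fst (f u) = fst (f w)))"

lemma parcs_copies_of_K: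
  "(p, r) \<in> parcs (copies_of_K s m) \<longleftrightarrow>
    p \<in> {1..s} \<times> {1..m} \<and> r \<in> {1..s} \<times> {1..m} \<and> p \<noteq> r \<and> fst p = fst r"
  by (cases p; cases r) (auto simp: disjoint_copies_def complete_graph_def)

lemma pverts_copies_of_K: "pverts (copies_of_K s m) = {1..s} \<times> {1..m}"
  by (simp add: disjoint_copies_def complete_graph_def)

text \<open>An isomorphism carries an arc map besides the vertex map. An arc here is the pair of its
  ends, so the arc map is forced to be \<open>map_prod f f\<close> and only the vertex bijection
  carries information.\<close>

lemma digraph_iso_copies_of_K_iff:
  "digraph_iso (with_proj G \<restriction> A) (with_proj (copies_of_K s m)) \<longleftrightarrow> cliques_on (parcs G) A s m"
  (is "digraph_iso ?G ?K \<longleftrightarrow> _")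
proof
  assume "digraph_iso ?G ?K"
  then obtain h where h: "pre_digraph.digraph_isomorphism ?G h" and K: "?K = app_iso h ?G"
    by (auto simp: digraph_iso_def)
  define f where "f = iso_verts h"
  have inj: "inj_on f A"
    using h by (simp add: pre_digraph.digraph_isomorphism_def f_def)
  have verts: "f ` A = {1..s} \<times> {1..m}"
    using arg_cong[OF K, of verts]
    unfolding with_proj_simps app_iso_simps induce_subgraph_verts pverts_copies_of_K f_def by simp
  have arcs: "iso_arcs h ` arcs ?G = parcs (copies_of_K s m)"
    using arg_cong[OF K, of arcs] by simp
  \<comment> \<open>\<open>app_iso\<close> takes its end functions from \<open>h\<close>, so
    equality with \<open>?K\<close> forces them to be the two projections.\<close>
  have ends: "iso_tail h = fst" "iso_head h = snd"
    using arg_cong[OF K, of tail] arg_cong[OF K, of head] by simp_all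
  have map: "iso_arcs h a = (f (fst a), f (snd a))" if "a \<in> arcs ?G" for a
  proof -
    have "f (tail ?G a) = iso_tail h (iso_arcs h a) \<and> f (head ?G a) = iso_head h (iso_arcs h a)"
      using h that unfolding pre_digraph.digraph_isomorphism_def f_def by blast
    then show ?thesis by (simp add: ends)
  qed
  have "(u, w) \<in> parcs G \<longleftrightarrow> u \<noteq> w \<and> fst (f u) = fst (f w)" if uw: "u \<in> A" "w \<in> A" for u w
  proof -
    have "(u, w) \<in> parcs G \<longleftrightarrow> (f u, f w) \<in> parcs (copies_of_K s m)"
    proof
      assume "(u, w) \<in> parcs G"
      with uw have a: "(u, w) \<in> arcs ?G" by simp
      then have "iso_arcs h (u, w) \<in> parcs (copies_of_K s m)"
        unfolding arcs[symmetric] by (rule imageI)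
      with map[OF a] show "(f u, f w) \<in> parcs (copies_of_K s m)" by simp
    next
      assume "(f u, f w) \<in> parcs (copies_of_K s m)"
      then obtain a where a: "a \<in> arcs ?G" "iso_arcs h a = (f u, f w)"
        unfolding arcs[symmetric] by auto
      then have "f (fst a) = f u" "f (snd a) = f w" using map by auto
      then have "a = (u, w)"
        using a(1) uw inj_onD[OF inj] by (auto simp: prod_eq_iff)
      with a(1) show "(u, w) \<in> parcs G" by simp
    qed
    also have "\<dots> \<longleftrightarrow> u \<noteq> w \<and> fst (f u) = fst (f w)"
      using uw verts inj_on_eq_iff[OF inj] unfolding parcs_copies_of_K by blast
    finally show ?thesis .
  qed
  with inj verts show "cliques_on (parcs G) A s m"
    unfolding cliques_on_def by (blast intro: bij_betw_imageI)
next
  assume "cliques_on (parcs G) A s m"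
  then obtain f where bij: "bij_betw f A ({1..s} \<times> {1..m})"
    and adj: "\<And>u w. u \<in> A \<Longrightarrow> w \<in> A \<Longrightarrow> (u, w) \<in> parcs G \<longleftrightarrow> u \<noteq> w \<and> fst (f u) = fst (f w)"
    unfolding cliques_on_def by blast
  note inj = bij_betw_imp_inj_on[OF bij] and img = bij_betw_imp_surj_on[OF bij]
  \<comment> \<open>The image must equal \<open>?K\<close> as a record, so the end functions are the
    projections.\<close>
  define h where
    "h = \<lparr>iso_verts = f, iso_arcs = map_prod f f, iso_head = snd, iso_tail = fst\<rparr>"
  have arcs: "arcs ?G = {(u, w). u \<in> A \<and> w \<in> A \<and> u \<noteq> w \<and> fst (f u) = fst (f w)}"
    using adj by auto
  have "wf_digraph ?G" by unfold_locales auto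
  moreover have "inj_on (map_prod f f) (arcs ?G)"
    by (rule inj_on_subset[OF map_prod_inj_on[OF inj inj]]) auto
  ultimately have "pre_digraph.digraph_isomorphism ?G h"
    using inj by (simp add: pre_digraph.digraph_isomorphism_def h_def)
  moreover have "map_prod f f ` arcs ?G = parcs (copies_of_K s m)"
  proof (intro set_eqI iffI)
    fix a assume "a \<in> map_prod f f ` arcs ?G"
    then obtain u w where uw: "u \<in> A" "w \<in> A" "u \<noteq> w" "fst (f u) = fst (f w)" "a = (f u, f w)"
      unfolding arcs by auto
    then have "f u \<in> {1..s} \<times> {1..m}" "f w \<in> {1..s} \<times> {1..m}" "f u \<noteq> f w"
      using inj_on_eq_iff[OF inj] unfolding img[symmetric] by simp_all
    with uw show "a \<in> parcs (copies_of_K s m)"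
      by (simp only: parcs_copies_of_K simp_thms)
  next
    fix a assume a: "a \<in> parcs (copies_of_K s m)"
    obtain p r where pr: "a = (p, r)" by (cases a)
    with a have "p \<in> f ` A" "r \<in> f ` A" "p \<noteq> r" "fst p = fst r"
      unfolding img parcs_copies_of_K pr by simp_all
    then obtain u w where "u \<in> A" "w \<in> A" "p = f u" "r = f w" "u \<noteq> w" "fst (f u) = fst (f w)"
      by blast
    then show "a \<in> map_prod f f ` arcs ?G"
      unfolding arcs pr by (intro image_eqI[of _ _ "(u, w)"]) auto
  qed
  then have "?K = app_iso h ?G"
    using img
    by (simp add: app_iso_def h_def with_proj_def pverts_copies_of_K induce_subgraph_def
        del: One_nat_def)
  ultimately show "digraph_iso ?G ?K"
    by (auto simp: digraph_iso_def)
qed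

lemma has_constant_link_copies_of_K_iff:
  "has_constant_link G (copies_of_K s m) \<longleftrightarrow>
    (\<forall>v \<in> pverts G. cliques_on (parcs G) (open_nbhd G v) s m)"
  by (simp only: has_constant_link_def digraph_iso_copies_of_K_iff)

lemma cliques_on_empty: "cliques_on R {} 0 m"
  by (simp add: cliques_on_def bij_betw_def)

text \<open>Composing the labelling with \<open>h\<close> labels \<open>B\<close>. The two relations
  may live on different types, as is the case when the link in \<open>G\<close> is moved into a copy
  of \<open>G\<close>.\<close>

lemma cliques_on_transfer:
  assumes "cliques_on R A s m" and h: "bij_betw h B A"
    and R': "\<And>u w. u \<in> B \<Longrightarrow> w \<in> B \<Longrightarrow> (u, w) \<in> R' \<longleftrightarrow> (h u, h w) \<in> R"
  shows "cliques_on R' B s m"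
proof -
  obtain f where f: "bij_betw f A ({1..s} \<times> {1..m})"
    and adj: "\<And>u w. u \<in> A \<Longrightarrow> w \<in> A \<Longrightarrow> (u, w) \<in> R \<longleftrightarrow> u \<noteq> w \<and> fst (f u) = fst (f w)"
    using assms(1) unfolding cliques_on_def by blast
  have "(u, w) \<in> R' \<longleftrightarrow> u \<noteq> w \<and> fst ((f \<circ> h) u) = fst ((f \<circ> h) w)" if "u \<in> B" "w \<in> B" for u w
    using that R' adj bij_betwE[OF h] inj_on_eq_iff[OF bij_betw_imp_inj_on[OF h]] by simp
  then show ?thesis
    unfolding cliques_on_def using bij_betw_trans[OF h f] by blast
qed

text \<open>All of \<open>B\<close> receives the fresh index \<open>Suc s\<close>, while the indices
  on \<open>A\<close> stay at most \<open>s\<close>. So no index is shared between the two parts,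
  matching the absence of arcs between them.\<close>

lemma cliques_on_add_clique:
  assumes "cliques_on R A s m" and B: "finite B" "card B = m" and disj: "A \<inter> B = {}"
    and clique: "\<And>u w. u \<in> B \<Longrightarrow> w \<in> B \<Longrightarrow> (u, w) \<in> R \<longleftrightarrow> u \<noteq> w"
    and sep: "\<And>u w. u \<in> A \<Longrightarrow> w \<in> B \<Longrightarrow> (u, w) \<notin> R \<and> (w, u) \<notin> R"
  shows "cliques_on R (A \<union> B) (Suc s) m"
proof -
  obtain f where f: "bij_betw f A ({1..s} \<times> {1..m})"
    and adj: "\<And>u w. u \<in> A \<Longrightarrow> w \<in> A \<Longrightarrow> (u, w) \<in> R \<longleftrightarrow> u \<noteq> w \<and> fst (f u) = fst (f w)"
    using assms(1) unfolding cliques_on_def by blast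
  have "card B = card ({Suc s} \<times> {1..m})" using B by (simp add: card_cartesian_product)
  then obtain f' where f': "bij_betw f' B ({Suc s} \<times> {1..m})"
    using finite_same_card_bij[OF B(1)] by (metis finite.emptyI finite.insertI finite_SigmaI finite_atLeastAtMost)
  define F where "F u = (if u \<in> A then f u else f' u)" for u
  have FA: "F u = f u" if "u \<in> A" for u using that by (simp add: F_def)
  have FB: "F u = f' u" if "u \<in> B" for u using that disj by (auto simp: F_def)
  have "bij_betw F A ({1..s} \<times> {1..m})" "bij_betw F B ({Suc s} \<times> {1..m})"
    using f f' FA FB by (simp_all cong: bij_betw_cong)
  then have "bij_betw F (A \<union> B) ({1..s} \<times> {1..m} \<union> {Suc s} \<times> {1..m})"
    by (rule bij_betw_combine) auto
  also have "{1..s} \<times> {1..m} \<union> {Suc s} \<times> {1..m} = {1..Suc s} \<times> {1..m}"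
    by auto
  finally have bij: "bij_betw F (A \<union> B) ({1..Suc s} \<times> {1..m})" .
  have fst_A: "fst (F u) \<le> s" if "u \<in> A" for u
    using bij_betwE[OF f] that FA by fastforce
  have fst_B: "fst (F u) = Suc s" if "u \<in> B" for u
    using bij_betwE[OF f'] that FB by fastforce
  have "(u, w) \<in> R \<longleftrightarrow> u \<noteq> w \<and> fst (F u) = fst (F w)" if "u \<in> A \<union> B" "w \<in> A \<union> B" for u w
  proof (cases "u \<in> A \<longleftrightarrow> w \<in> A")
    case True
    then show ?thesis using that adj clique FA fst_B by auto
  next
    case False
    then have "(u, w) \<notin> R" using that sep by blast
    moreover have "fst (F u) \<noteq> fst (F w)" using False that fst_A fst_B by force
    ultimately show ?thesis by simp
  qed
  with bij show ?thesis unfolding cliques_on_def by blast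
qed

lemma cliques_on_card: "cliques_on R A s m \<Longrightarrow> card A = s * m"
  by (auto simp: cliques_on_def card_cartesian_product dest!: bij_betw_same_card)

text \<open>The neighbours of \<open>v\<close> are the other members of its own clique. Applied to
  qK_k, this is the start of the recursion, with a single K_{k-1} as link.\<close>

lemma constant_link_disjoint_cliques:
  assumes G: "pair_graph G" and cl: "cliques_on (parcs G) (pverts G) s m"
  shows "has_constant_link G (copies_of_K 1 (m - 1))"
  unfolding has_constant_link_copies_of_K_iff
proof
  interpret pair_graph G by (rule G)
  fix v assume v: "v \<in> pverts G"
  obtain f where f: "bij_betw f (pverts G) ({1..s} \<times> {1..m})"
    and adj: "\<And>u w. u \<in> pverts G \<Longrightarrow> w \<in> pverts G \<Longrightarrow>
      (u, w) \<in> parcs G \<longleftrightarrow> u \<noteq> w \<and> fst (f u) = fst (f w)"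
    using cl unfolding cliques_on_def by blast
  define C where "C = {u \<in> pverts G. fst (f u) = fst (f v)}"
  have nbhd: "open_nbhd G v = C - {v}"
  proof (rule set_eqI)
    fix u
    show "u \<in> open_nbhd G v \<longleftrightarrow> u \<in> C - {v}"
      using adj[OF v, of u] in_arcsD2[of v u] by (auto simp: open_nbhd_def C_def)
  qed
  \<comment> \<open>The clique \<open>C\<close> of \<open>v\<close> corresponds to a full row of
    labels, hence has \<open>m\<close> elements.\<close>
  have "bij_betw f C ({fst (f v)} \<times> {1..m})"
  proof (rule bij_betw_subset[OF f])
    show "C \<subseteq> pverts G" by (auto simp: C_def)
    show "f ` C = {fst (f v)} \<times> {1..m}"
    proof
      show "f ` C \<subseteq> {fst (f v)} \<times> {1..m}"
      proof (rule image_subsetI)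
        fix u assume "u \<in> C"
        then show "f u \<in> {fst (f v)} \<times> {1..m}"
          using bij_betwE[OF f, rule_format, of u] by (simp add: C_def mem_Times_iff)
      qed
      show "{fst (f v)} \<times> {1..m} \<subseteq> f ` C"
      proof
        fix p assume p: "p \<in> {fst (f v)} \<times> {1..m}"
        have "f v \<in> {1..s} \<times> {1..m}" using bij_betwE[OF f] v by blast
        with p have "p \<in> f ` pverts G"
          unfolding bij_betw_imp_surj_on[OF f] by (simp add: mem_Times_iff)
        then obtain u where "u \<in> pverts G" "p = f u" by blast
        moreover from this p have "u \<in> C" by (simp add: C_def mem_Times_iff)
        ultimately show "p \<in> f ` C" by blast
      qed
    qed
  qed
  then have "card C = m" by (auto dest!: bij_betw_same_card simp: card_cartesian_product)
  moreover have "finite C" using pair_finite_verts by (simp add: C_def)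
  moreover have "v \<in> C" using v by (simp add: C_def)
  ultimately have "finite (C - {v})" "card (C - {v}) = m - 1" by simp_all
  \<comment> \<open>A single clique arises by adding it to the empty union.\<close>
  then have "cliques_on (parcs G) ({} \<union> (C - {v})) (Suc 0) (m - 1)"
    by (intro cliques_on_add_clique cliques_on_empty) (auto simp: adj C_def)
  then show "cliques_on (parcs G) (open_nbhd G v) 1 (m - 1)"
    by (simp add: nbhd)
qed

section \<open>Regularity of Steiner systems\<close>

lemma steiner_system_2_regular:
  assumes st: "steiner_system_2 k v H" and k: "k \<ge> 2"
    and n: "real n = (real v - 1) / (real k - 1)"
  shows "regular_uniform_hypergraph n k H"
proof -
  have V: "finite (fst H)" "card (fst H) = v"
    and B: "\<And>B. B \<in> snd H \<Longrightarrow> B \<subseteq> fst H \<and> card B = k"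
    and P: "\<And>P. P \<subseteq> fst H \<Longrightarrow> card P = 2 \<Longrightarrow> \<exists>!B. B \<in> snd H \<and> P \<subseteq> B"
    using st unfolding steiner_system_2_def by blast+
  have "card (hyperedges_at H x) = n" if x: "x \<in> fst H" for x
  proof -
    let ?A = "hyperedges_at H x"
    have fin: "finite ?A"
      by (rule finite_subset[of _ "Pow (fst H)"]) (use V B in \<open>auto simp: hyperedges_at_def\<close>)
    have pair: "\<exists>!B. B \<in> snd H \<and> {x, y} \<subseteq> B" if "y \<in> fst H" "y \<noteq> x" for y
      using that x by (intro P) auto
    \<comment> \<open>Existence of a block through \<open>x\<close> and \<open>y\<close> gives this
      covering; its uniqueness gives the disjointness used for the cardinality below.\<close>
    have "fst H - {x} = (\<Union>B\<in>?A. B - {x})"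
    proof
      show "fst H - {x} \<subseteq> (\<Union>B\<in>?A. B - {x})"
        using pair by (fastforce simp: hyperedges_at_def)
      show "(\<Union>B\<in>?A. B - {x}) \<subseteq> fst H - {x}"
        using B by (auto simp: hyperedges_at_def)
    qed
    moreover have "card (\<Union>B\<in>?A. B - {x}) = (\<Sum>B\<in>?A. card (B - {x}))"
    proof (rule card_UN_disjoint[OF fin])
      show "\<forall>B\<in>?A. finite (B - {x})"
        using B V finite_subset by (fastforce simp: hyperedges_at_def)
      show "\<forall>B\<in>?A. \<forall>B'\<in>?A. B \<noteq> B' \<longrightarrow> (B - {x}) \<inter> (B' - {x}) = {}"
      proof (intro ballI impI, rule ccontr)
        fix B1 B2 assume B12: "B1 \<in> ?A" "B2 \<in> ?A" "B1 \<noteq> B2" "(B1 - {x}) \<inter> (B2 - {x}) \<noteq> {}"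
        then obtain y where y: "y \<in> B1" "y \<in> B2" "y \<noteq> x" by blast
        then have "y \<in> fst H" using B B12(1) by (auto simp: hyperedges_at_def)
        from pair[OF this y(3)] B12 y show False by (auto simp: hyperedges_at_def)
      qed
    qed
    moreover have "(\<Sum>B\<in>?A. card (B - {x})) = (\<Sum>B\<in>?A. k - 1)"
      using B by (intro sum.cong) (auto simp: hyperedges_at_def)
    moreover have "card (fst H - {x}) = v - 1" using V x by simp
    ultimately have "v - 1 = card ?A * (k - 1)"
      by (metis sum_constant of_nat_id)
    \<comment> \<open>Makes the truncated difference \<open>v - 1\<close> agree with the real
      one.\<close>
    moreover have "v \<ge> 1" using V x card_gt_0_iff[of "fst H"] by force
    ultimately have "real v - 1 = real (card ?A) * (real k - 1)"
      using k by (metis One_nat_def Suc_1 Suc_leD of_nat_1 of_nat_diff of_nat_mult)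
    with n k show ?thesis by simp
  qed
  with V B show ?thesis by (simp add: regular_uniform_hypergraph_def)
qed

section \<open>One step of the construction\<close>

text \<open>Fixes arbitrary enumerations \<open>g\<close> and \<open>e\<close>, so that what is
  proved here holds for every choice of them.\<close>

locale Gamma_enumeration =
  fixes k :: nat and G :: "'a pair_pre_digraph" and H :: "'b hypergraph"
    and g :: "'b \<Rightarrow> nat \<Rightarrow> 'a" and e :: "'b \<Rightarrow> nat \<Rightarrow> 'b set"
  assumes graph: "pair_graph G"
    and regular: "regular_uniform_hypergraph (card (pverts G)) k H"
    and g: "\<And>x. x \<in> fst H \<Longrightarrow> bij_betw (g x) {1..card (pverts G)} (pverts G)"
    and e: "\<And>x. x \<in> fst H \<Longrightarrow> bij_betw (e x) {1..card (hyperedges_at H x)} (hyperedges_at H x)"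
begin

abbreviation "N \<equiv> {1..card (pverts G)}"

abbreviation "\<Gamma> \<equiv> Gamma_graph G H g e"

text \<open>The degree of \<open>H\<close> is the order of \<open>G\<close>, so hyperedges at
  \<open>x\<close> and vertices of the copy at \<open>x\<close> share the index set
  \<open>N\<close>: each vertex of the copy carries exactly one hyperedge.\<close>

lemma e_bij: "x \<in> fst H \<Longrightarrow> bij_betw (e x) N (hyperedges_at H x)"
  using e regular unfolding regular_uniform_hypergraph_def by force

lemma e_eq_iff: "x \<in> fst H \<Longrightarrow> i \<in> N \<Longrightarrow> j \<in> N \<Longrightarrow> e x i = e x j \<longleftrightarrow> i = j"
  by (rule inj_on_eq_iff[OF bij_betw_imp_inj_on[OF e_bij]])

lemma e_in: "x \<in> fst H \<Longrightarrow> i \<in> N \<Longrightarrow> e x i \<in> snd H \<and> x \<in> e x i"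
  using bij_betwE[OF e_bij] by (auto simp: hyperedges_at_def)

lemma G_adj_in: "(u, w) \<in> parcs G \<Longrightarrow> u \<in> pverts G \<and> w \<in> pverts G \<and> u \<noteq> w \<and> (w, u) \<in> parcs G"
proof -
  interpret pair_graph G by (rule graph)
  assume "(u, w) \<in> parcs G"
  then show ?thesis
    using wellformed' no_loops' arcs_symmetric by blast
qed

lemma pverts_Gamma: "pverts \<Gamma> = fst H \<times> N"
  by (simp add: Gamma_graph_def)

text \<open>Injectivity of \<open>e x\<close> lets a clique set meet the copy at \<open>x\<close> at
  most once. So clique arcs never run inside a copy, and the two sources of arcs are told apart by
  whether \<open>x = y\<close>.\<close>

lemma parcs_Gamma_iff:
  "((x, i), (y, j)) \<in> parcs \<Gamma> \<longleftrightarrow>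
    x \<in> fst H \<and> y \<in> fst H \<and> i \<in> N \<and> j \<in> N \<and>
    (if x = y then (g x i, g x j) \<in> parcs G else e x i = e y j)"
  (is "_ \<longleftrightarrow> ?R")
proof -
  have "((x, i), (y, j)) \<in> parcs \<Gamma> \<longleftrightarrow>
    x \<in> fst H \<and> y \<in> fst H \<and> i \<in> N \<and> j \<in> N \<and>
    (x = y \<and> (g x i, g x j) \<in> parcs G \<or>
     (x, i) \<noteq> (y, j) \<and> e x i = e y j \<and> e x i \<in> snd H)"
    by (auto simp: Gamma_graph_def complete_graph_def Gamma_clique_set_def)
  also have "\<dots> \<longleftrightarrow> ?R"
    using e_eq_iff e_in by (auto split: if_splits)
  finally show ?thesis .
qed

lemma pair_graph_Gamma: "pair_graph \<Gamma>"
proof -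
  have fin: "finite (pverts \<Gamma>)"
    using regular by (simp add: pverts_Gamma regular_uniform_hypergraph_def)
  have sub: "parcs \<Gamma> \<subseteq> pverts \<Gamma> \<times> pverts \<Gamma>"
    by (auto simp: parcs_Gamma_iff pverts_Gamma)
  have "(b, a) \<in> parcs \<Gamma> \<and> a \<noteq> b" if "(a, b) \<in> parcs \<Gamma>" for a b
    using that by (cases a; cases b) (auto simp: parcs_Gamma_iff dest: G_adj_in split: if_splits)
  then show ?thesis
    using fin sub finite_subset[OF sub]
    by unfold_locales (auto simp: symmetric_def sym_def)
qed

lemma card_pverts_Gamma: "card (pverts \<Gamma>) = card (fst H) * card (pverts G)"
  by (simp add: pverts_Gamma card_cartesian_product)

lemma constant_link_Gamma:
  assumes link: "has_constant_link G (copies_of_K s (k - 1))"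
  shows "has_constant_link \<Gamma> (copies_of_K (Suc s) (k - 1))"
  unfolding has_constant_link_copies_of_K_iff
proof
  fix p assume "p \<in> pverts \<Gamma>"
  then obtain x j where p: "p = (x, j)" and x: "x \<in> fst H" and j: "j \<in> N"
    by (auto simp: pverts_Gamma)
  define E where "E = e x j"
  \<comment> \<open>\<open>A\<close> holds the neighbours inside the copy at \<open>x\<close>;
    \<open>C\<close> is the clique set of the hyperedge carried by \<open>p\<close>, including
    \<open>p\<close>.\<close>
  define A where "A = {x} \<times> {i \<in> N. (g x j, g x i) \<in> parcs G}"
  define C where "C = {(y, i). y \<in> fst H \<and> i \<in> N \<and> e y i = E}"
  have E: "E \<in> snd H" "x \<in> E" using e_in[OF x j] by (simp_all add: E_def)
  then have EV: "E \<subseteq> fst H" "card E = k"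
    using regular by (auto simp: regular_uniform_hypergraph_def)
  have nbhd: "open_nbhd \<Gamma> p = A \<union> (C - {p})"
  proof (rule set_eqI)
    fix u :: "'b \<times> nat"
    obtain y i where u: "u = (y, i)" by (cases u)
    show "u \<in> open_nbhd \<Gamma> p \<longleftrightarrow> u \<in> A \<union> (C - {p})"
      using x j e_eq_iff[OF x _ j, of i]
      by (cases "y = x") (auto simp: u open_nbhd_def p parcs_Gamma_iff A_def C_def E_def)
  qed
  have gx: "g x j \<in> pverts G" using bij_betwE[OF g[OF x]] j by blast
  have A_bij: "bij_betw (g x \<circ> snd) A (open_nbhd G (g x j))"
  proof (rule bij_betw_imageI)
    show "inj_on (g x \<circ> snd) A"
      by (intro comp_inj_on inj_on_subset[OF bij_betw_imp_inj_on[OF g[OF x]]])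
        (auto simp: A_def inj_on_def)
    show "(g x \<circ> snd) ` A = open_nbhd G (g x j)"
    proof
      show "(g x \<circ> snd) ` A \<subseteq> open_nbhd G (g x j)"
        by (auto simp: A_def open_nbhd_def)
      show "open_nbhd G (g x j) \<subseteq> (g x \<circ> snd) ` A"
      proof
        fix u assume u: "u \<in> open_nbhd G (g x j)"
        then have "u \<in> g x ` N"
          using G_adj_in bij_betw_imp_surj_on[OF g[OF x]] by (simp add: open_nbhd_def)
        then obtain i where i: "i \<in> N" "u = g x i" by blast
        with u have "(x, i) \<in> A" by (simp add: A_def open_nbhd_def)
        moreover have "u = (g x \<circ> snd) (x, i)" by (simp add: i(2))
        ultimately show "u \<in> (g x \<circ> snd) ` A" by (rule rev_image_eqI)
      qed
    qed
  qed
  \<comment> \<open>The enumeration \<open>g x\<close> identifies \<open>A\<close> with the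
    neighbourhood of \<open>g x j\<close> in \<open>G\<close>, so the \<open>s\<close> cliques are
    inherited.\<close>
  have clA: "cliques_on (parcs \<Gamma>) A s (k - 1)"
  proof (rule cliques_on_transfer[OF _ A_bij])
    show "cliques_on (parcs G) (open_nbhd G (g x j)) s (k - 1)"
      using link gx unfolding has_constant_link_copies_of_K_iff by blast
  qed (use x in \<open>auto simp: A_def parcs_Gamma_iff\<close>)
  \<comment> \<open>Each \<open>y\<close> in \<open>E\<close> lies in \<open>C\<close> with exactly
    one index: surjectivity of \<open>e y\<close> gives existence, injectivity uniqueness.\<close>
  have "bij_betw fst C E"
  proof (rule bij_betw_imageI)
    show "inj_on fst C"
      using e_eq_iff by (auto simp: C_def inj_on_def)
    have "\<exists>i \<in> N. e y i = E" if "y \<in> E" for y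
    proof -
      have y: "y \<in> fst H" "E \<in> hyperedges_at H y"
        using that E EV by (auto simp: hyperedges_at_def)
      then have "E \<in> e y ` N" by (simp only: bij_betw_imp_surj_on[OF e_bij[OF y(1)]])
      then show ?thesis by blast
    qed
    then have "E \<subseteq> fst ` C"
      using EV(1) by (fastforce simp: C_def image_iff)
    moreover have "fst ` C \<subseteq> E"
      using e_in by (auto simp: C_def)
    ultimately show "fst ` C = E" by blast
  qed
  then have "card C = k" using EV bij_betw_same_card by metis
  moreover have "finite C"
    by (rule finite_subset[of _ "pverts \<Gamma>"])
      (use regular in \<open>auto simp: C_def pverts_Gamma regular_uniform_hypergraph_def\<close>)
  moreover have "p \<in> C" using x j by (simp add: p C_def E_def)
  ultimately have B: "finite (C - {p})" "card (C - {p}) = k - 1" by simp_all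
  \<comment> \<open>A member of \<open>C\<close> in the copy at \<open>x\<close> has index
    \<open>j\<close>, hence is \<open>p\<close>.\<close>
  have fst_ne: "fst u \<noteq> x" if "u \<in> C - {p}" for u
    using that j e_eq_iff[OF x] by (auto simp: C_def p E_def)
  have "cliques_on (parcs \<Gamma>) (A \<union> (C - {p})) (Suc s) (k - 1)"
  proof (rule cliques_on_add_clique[OF clA B])
    show "A \<inter> (C - {p}) = {}" using fst_ne by (force simp: A_def)
    show "(u, w) \<in> parcs \<Gamma> \<longleftrightarrow> u \<noteq> w" if "u \<in> C - {p}" "w \<in> C - {p}" for u w
      using that e_eq_iff by (cases u; cases w) (auto simp: C_def parcs_Gamma_iff dest: G_adj_in)
    \<comment> \<open>The vertices lie in different copies, so an arc would need equal hyperedges.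
      But \<open>u\<close> has an index \<open>i\<close> different from \<open>j\<close>, as
      \<open>G\<close> has no loops, and so carries a hyperedge other than \<open>E\<close>.\<close>
    show "(u, w) \<notin> parcs \<Gamma> \<and> (w, u) \<notin> parcs \<Gamma>" if u: "u \<in> A" and w: "w \<in> C - {p}" for u w
    proof -
      obtain i where i: "u = (x, i)" "i \<in> N" "(g x j, g x i) \<in> parcs G"
        using u by (auto simp: A_def)
      then have "i \<noteq> j" using G_adj_in by blast
      then have "e x i \<noteq> E" using e_eq_iff[OF x i(2) j] by (simp add: E_def)
      then show ?thesis
        using w fst_ne[OF w] by (cases w) (auto simp: i C_def parcs_Gamma_iff)
    qed
  qed
  then show "cliques_on (parcs \<Gamma>) (open_nbhd \<Gamma> p) (Suc s) (k - 1)"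
    by (simp add: nbhd)
qed

end

text \<open>Frees the locale results from the chosen enumerations, in the form used by the induction
  over the recursion.\<close>

lemma is_Gamma_properties:
  assumes adm: "pair_graph G" "regular_uniform_hypergraph (card (pverts G)) k H"
    and link: "has_constant_link G (copies_of_K s (k - 1))"
    and "is_Gamma G H G'"
  shows "pair_graph G'" and "card (pverts G') = card (fst H) * card (pverts G)"
    and "has_constant_link G' (copies_of_K (Suc s) (k - 1))"
proof -
  obtain g e where ge: "Gamma_enumeration k G H g e" and G': "G' = Gamma_graph G H g e"
    using assms unfolding is_Gamma_def Gamma_enumeration_def by blast
  interpret Gamma_enumeration k G H g e by (rule ge)
  show "pair_graph G'" "card (pverts G') = card (fst H) * card (pverts G)"
    "has_constant_link G' (copies_of_K (Suc s) (k - 1))"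
    using pair_graph_Gamma card_pverts_Gamma constant_link_Gamma[OF link] by (simp_all add: G')
qed

section \<open>Existence of a run of the recursion\<close>

text \<open>One enumeration of the vertices of \<open>G\<close> serves all copies; the hyperedges
  are enumerated separately at each point.\<close>

lemma ex_is_Gamma:
  assumes "finite (pverts G)" and "\<And>x. x \<in> fst H \<Longrightarrow> finite (hyperedges_at H x)"
  shows "\<exists>G'. is_Gamma G H G'"
proof -
  obtain h where "bij_betw h {1..card (pverts G)} (pverts G)"
    using ex_bij_betw_nat_finite_1[OF assms(1)] by blast
  moreover have "\<forall>x \<in> fst H. \<exists>f. bij_betw f {1..card (hyperedges_at H x)} (hyperedges_at H x)"
    using ex_bij_betw_nat_finite_1 assms(2) by blast
  then obtain e where "\<forall>x \<in> fst H. bij_betw (e x) {1..card (hyperedges_at H x)} (hyperedges_at H x)"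
    by (metis (no_types))
  ultimately show ?thesis
    unfolding is_Gamma_def by (intro exI[of _ "Gamma_graph G H (\<lambda>_. h) e"] exI[of _ "\<lambda>_. h"]) blast
qed

lemma finite_pverts_is_Gamma:
  "is_Gamma G H G' \<Longrightarrow> finite (fst H) \<Longrightarrow> finite (pverts G')"
  by (auto simp: is_Gamma_def Gamma_graph_def)

text \<open>The first graph must live on the vertex type of the later ones. An infinite type has a
  finite subset of the right size, and the clique structure is pulled back to it along a
  bijection.\<close>

lemma ex_copies_of_K:
  assumes "infinite (UNIV :: 'c set)"
  shows "\<exists>G :: 'c pair_pre_digraph. pair_graph G \<and> digraph_iso (with_proj G) (with_proj (copies_of_K q k))"
proof -
  obtain A :: "'c set" where A: "finite A" "card A = card ({1..q} \<times> {1..k})"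
    using infinite_arbitrarily_large[OF assms] by blast
  then obtain f where f: "bij_betw f A ({1..q} \<times> {1..k})"
    using finite_same_card_bij by (metis finite_SigmaI finite_atLeastAtMost)
  define G where "G = \<lparr>pverts = A, parcs = {(u, w). u \<in> A \<and> w \<in> A \<and> u \<noteq> w \<and> fst (f u) = fst (f w)}\<rparr>"
  have "parcs G \<subseteq> A \<times> A" by (auto simp: G_def)
  then have "pair_graph G"
    using A(1) finite_subset[of "parcs G" "A \<times> A"]
    by unfold_locales (auto simp: G_def symmetric_def sym_def)
  moreover have "cliques_on (parcs G) A q k"
    using f unfolding cliques_on_def by (auto simp: G_def)
  \<comment> \<open>Inducing on the whole vertex set changes nothing, so the characterization for
    induced subgraphs applies to \<open>G\<close> itself.\<close>
  moreover have "with_proj G \<restriction> A = with_proj G"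
    by (auto simp: induce_subgraph_def with_proj_def G_def)
  ultimately show ?thesis using digraph_iso_copies_of_K_iff by metis
qed

text \<open>Each graph depends on the choices made for the one before it, so the run is obtained by
  dependent choice, with finiteness of the vertex set as the property carried along.\<close>

lemma ex_S_sequence:
  fixes H :: "nat \<Rightarrow> 'b hypergraph"
  assumes H: "\<And>i. i \<in> {1..<t} \<Longrightarrow> finite (fst (H i))"
    "\<And>i x. i \<in> {1..<t} \<Longrightarrow> x \<in> fst (H i) \<Longrightarrow> finite (hyperedges_at (H i) x)"
  shows "\<exists>S. S_sequence k q t H S"
proof -
  have "infinite (UNIV :: ('b \<times> nat) set)"
    using finite_prod by blast
  then obtain G :: "('b \<times> nat) pair_pre_digraph" where G: "pair_graph G"
    and iso: "digraph_iso (with_proj G) (with_proj (copies_of_K q k))"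
    using ex_copies_of_K by blast
  interpret G: pair_graph G by (rule G)
  \<comment> \<open>Choice starts at 0, so position \<open>i\<close> stands for the graph with
    number \<open>i + 1\<close>, and the next step uses \<open>H (Suc i)\<close>. Outside the range
    any finite graph, such as \<open>G\<close>, continues the sequence.\<close>
  let ?P = "\<lambda>i X. finite (pverts X) \<and> (i = 0 \<longrightarrow> X = G)"
  let ?Q = "\<lambda>i X Y. Suc i \<in> {1..<t} \<longrightarrow> is_Gamma X (H (Suc i)) Y"
  have "\<exists>f. \<forall>i. ?P i (f i) \<and> ?Q i (f i) (f (Suc i))"
  proof (rule dependent_nat_choice)
    show "\<exists>X. ?P 0 X" using G.pair_finite_verts by blast
    show "\<exists>Y. ?P (Suc i) Y \<and> ?Q i X Y" if "?P i X" for X i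
    proof (cases "Suc i \<in> {1..<t}")
      case True
      then have "\<exists>Y. is_Gamma X (H (Suc i)) Y"
        using that H(2) by (intro ex_is_Gamma) auto
      then obtain Y where "is_Gamma X (H (Suc i)) Y" ..
      then show ?thesis using finite_pverts_is_Gamma H(1)[OF True] by blast
    next
      case False
      then show ?thesis using G.pair_finite_verts by blast
    qed
  qed
  then obtain f where f: "\<And>i. ?P i (f i) \<and> ?Q i (f i) (f (Suc i))" by blast
  have "is_Gamma (f (i - 1)) (H i) (f i)" if "i \<in> {1..<t}" for i
    using f[of "i - 1"] that by simp
  then have "S_sequence k q t H (\<lambda>i. f (i - 1))"
    using f[of 0] G iso by (simp add: S_sequence_def)
  then show ?thesis by blast
qed

section \<open>Order and link along every run\<close>

text \<open>The claim on order and link covers every run, that is, every choice of enumerations; the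
  existence part keeps it from being vacuous.\<close>

theorem theorem14:
  fixes k q t :: nat
    and v n :: "nat \<Rightarrow> nat"
    and H :: "nat \<Rightarrow> 'b hypergraph"
  assumes "k \<ge> 3" and "q \<ge> 1" and "t \<ge> 1"
    and steiner: "\<forall>i \<in> {1..<t}. steiner_system_2 k (v i) (H i)"
    and n_eq: "\<forall>i \<in> {1..<t}. real (n i) = (real (v i) - 1) / (real k - 1)"
    and n_1: "t \<ge> 2 \<Longrightarrow> n 1 = q * k"
    and n_j: "\<forall>j \<in> {2..<t}. n j = q * k * (\<Prod>i \<in> {1..<j}. v i)"
  shows "(\<exists>S. S_sequence k q t H S) \<and>
    (\<forall>S. S_sequence k q t H S \<longrightarrow>
      (\<forall>i \<in> {1..<t}. Gamma_admissible k (S i) (H i)) \<and>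
      pair_graph (S t) \<and>
      card (pverts (S t)) = k * q * (\<Prod>i \<in> {1..<t}. v i) \<and>
      has_constant_link (S t) (copies_of_K t (k - 1)))"
proof -
  have reg: "regular_uniform_hypergraph (n i) k (H i)" if "i \<in> {1..<t}" for i
    using steiner n_eq \<open>k \<ge> 3\<close> that by (intro steiner_system_2_regular[of k "v i"]) auto
  \<comment> \<open>At \<open>i = 1\<close> the product is empty, which merges the two assumptions
    on \<open>n\<close> into one formula.\<close>
  have n: "n i = k * q * (\<Prod>j \<in> {1..<i}. v j)" if "i \<in> {1..<t}" for i
    using that n_1 n_j by (cases "i = 1") (auto simp: mult.commute)
  have fin: "finite (fst (H i))" "card (fst (H i)) = v i" "\<forall>E \<in> snd (H i). E \<subseteq> fst (H i)"
    if "i \<in> {1..<t}" for i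
    using steiner that by (auto simp: steiner_system_2_def)
  have "finite (hyperedges_at (H i) x)" if "i \<in> {1..<t}" for i x
    by (rule finite_subset[of _ "Pow (fst (H i))"])
      (use fin[OF that] in \<open>auto simp: hyperedges_at_def\<close>)
  then have "\<exists>S. S_sequence k q t H S"
    using ex_S_sequence[of t H] fin(1) by blast
  moreover have "(\<forall>i \<in> {1..<t}. Gamma_admissible k (S i) (H i)) \<and>
      pair_graph (S t) \<and> card (pverts (S t)) = k * q * (\<Prod>i \<in> {1..<t}. v i) \<and>
      has_constant_link (S t) (copies_of_K t (k - 1))"
    if S: "S_sequence k q t H S" for S
  proof -
    have S1: "pair_graph (S 1)" "digraph_iso (with_proj (S 1)) (with_proj (copies_of_K q k))"
      and Gamma_step: "\<And>i. i \<in> {1..<t} \<Longrightarrow> is_Gamma (S i) (H i) (S (Suc i))"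
      using S by (auto simp: S_sequence_def)
    \<comment> \<open>The invariant of the recursion. For \<open>i\<close> below \<open>t\<close>
      the order in it is \<open>n i\<close>, the degree of \<open>H i\<close>.\<close>
    define I where "I i \<longleftrightarrow> pair_graph (S i) \<and>
      card (pverts (S i)) = k * q * (\<Prod>j \<in> {1..<i}. v j) \<and>
      has_constant_link (S i) (copies_of_K i (k - 1))" for i
    have I: "I i" if "1 \<le> i" "i \<le> t" for i
      using that
    proof (induction i rule: dec_induct)
      case base
      interpret pair_graph "S 1" by (rule S1(1))
      have "with_proj (S 1) \<restriction> pverts (S 1) = with_proj (S 1)"
        using wellformed' by (auto simp: induce_subgraph_def with_proj_def)
      with S1(2) have cl: "cliques_on (parcs (S 1)) (pverts (S 1)) q k"
        using digraph_iso_copies_of_K_iff by metis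
      show ?case
        using S1(1) constant_link_disjoint_cliques[OF S1(1) cl] cliques_on_card[OF cl]
        by (simp add: I_def)
    next
      case (step i)
      then have i: "i \<in> {1..<t}" and "I i" by simp_all
      then have inv: "pair_graph (S i)" "card (pverts (S i)) = k * q * (\<Prod>j \<in> {1..<i}. v j)"
        "has_constant_link (S i) (copies_of_K i (k - 1))"
        by (simp_all add: I_def)
      \<comment> \<open>Here the numerical assumptions enter: the order of \<open>S i\<close> equals
        the degree of \<open>H i\<close>, so the next step is admissible.\<close>
      have "regular_uniform_hypergraph (card (pverts (S i))) k (H i)"
        using reg[OF i] n[OF i] inv(2) by simp
      note next_S = is_Gamma_properties[OF inv(1) this inv(3) Gamma_step[OF i]]
      have "card (pverts (S (Suc i))) = k * q * (\<Prod>j \<in> {1..<Suc i}. v j)"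
        using next_S(2) inv(2) fin(2)[OF i] i by simp
      with next_S(1,3) show ?case by (simp add: I_def)
    qed
    \<comment> \<open>The number of cliques required by admissibility is \<open>i\<close> itself, at
      least 1.\<close>
    have "Gamma_admissible k (S i) (H i)" if i: "i \<in> {1..<t}" for i
      using I[of i] i reg[OF i] n[OF i] by (auto simp: Gamma_admissible_def I_def)
    with I[of t] \<open>t \<ge> 1\<close> show ?thesis by (simp add: I_def)
  qed
  ultimately show ?thesis by blast
qed

end
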